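(* Let $0<\lambda\le\frac{\pi}{2}$, $0\le\hat p\le 2\lambda$ and $p=\hat p/\lambda$ (so that $0\le p\le 2$). Suppose that $f(z)=z+\sum_{n=2}^{\infty}a_nz^n\in\mathcal{S}^{*}_{\lambda e}(\hat p)$. Then the following sharp inequalities hold: $$|a_3-a_2|\le\begin{cases}\frac1{16}\lambda\left[8+8p-(3\lambda+2)p^2\right], & 0\le p\le\frac{8}{3\lambda},\\[4pt] \frac1{16}\lambda\left[8-8p+(3\lambda-2)p^2\right], & \frac{8}{3\lambda}<p\le2,\end{cases}$$ and $$|a_4-a_3|\le\begin{cases}\Psi_1(\lambda,p), & 0<\lambda\le\frac35,\\[2pt] \Psi_2(\lambda,p), & \frac35<\lambda\le\frac{\pi}{2},\end{cases}$$ where $$\Psi_1(\lambda,p)=\begin{cases}\frac{\lambda}{1152}\left[7\lambda^2p^3+(150\lambda^2+36\lambda-96)p^2+(108-360\lambda)p+600\right], & 0\le p\le\frac{2}{4-5\lambda},\\[4pt] \frac{\lambda}{288}\left[(-17\lambda^2+30\lambda-12)p^3+(54\lambda-36)p^2+(48-120\lambda)p+144\right], & \frac{2}{4-5\lambda}<p\le2,\end{cases}$$ $$\Psi_2(\lambda,p)=\begin{cases}\frac{\lambda}{1152}\left[7\lambda^2p^3+(150\lambda^2+36\lambda-96)p^2+(108-360\lambda)p+600\right], & 0\le p\le\frac{14}{4+5\lambda},\\[4pt] \frac{\lambda}{288}\left[(-17\lambda^2-30\lambda-12)p^3+(54\lambda+36)p^2+(120\lambda+48)p-144\right], & \frac{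14}{4+5\lambda}<p\le2.\end{cases}$$
   Context: Let $\mathbb{D}=\{z\in\mathbb{C}:|z|<1\}$ and let $\mathcal{A}$ be the class of functions $f$ analytic in $\mathbb{D}$ of the form $f(z)=z+\sum_{n=2}^{\infty}a_nz^n$. For $g,h$ analytic in $\mathbb{D}$, $g\prec h$ ($g$ is subordinate to $h$) means that there is a Schwarz function $\omega$, i.e. $\omega$ analytic in $\mathbb{D}$ with $\omega(0)=0$ and $|\omega(z)|<1$ for $z\in\mathbb{D}$, such that $g(z)=h(\omega(z))$ for $z\in\mathbb{D}$. For a constant $\lambda$ with $0<\lambda\le\frac{\pi}{2}$, $\mathcal{S}^{*}_{\lambda e}$ is the class of $f\in\mathcal{A}$ with $\frac{zf'(z)}{f(z)}\prec e^{\lambda z}$ in $\mathbb{D}$. For a real number $\hat p$ with $-2\lambda\le\hat p\le2\lambda$, $\mathcal{S}^{*}_{\lambda e}(\hat p)=\{f\in\mathcal{S}^{*}_{\lambda e}: f''(0)=\hat p\}$. An inequality is sharp if, for each admissible value of the parameters $\lambda,\hat p$, its right-hand side cannot be replaced by a smaller number. *)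

theory Defs
  imports "HOL-Complex_Analysis.Complex_Analysis"
begin

abbreviation unit_disc :: "complex set" ("\<D>")
  where "\<D> \<equiv> ball 0 1"

definition taylor_coeff :: "(complex \<Rightarrow> complex) \<Rightarrow> nat \<Rightarrow> complex"
  where "taylor_coeff f n = fps_nth (fps_expansion f 0) n"

definition class_A :: "(complex \<Rightarrow> complex) set"
  where "class_A = {f. f holomorphic_on \<D> \<and>
    (\<forall>z\<in>\<D>. (\<lambda>n. taylor_coeff f (n + 2) * z ^ (n + 2)) sums (f z - z))}"

definition schwarz_function :: "(complex \<Rightarrow> complex) \<Rightarrow> bool"
  where "schwarz_function \<omega> \<longleftrightarrow>
    \<omega> holomorphic_on \<D> \<and> \<omega> 0 = 0 \<and> (\<forall>z\<in>\<D>. cmod (\<omega> z) < 1)"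

definition subordinate :: "(complex \<Rightarrow> complex) \<Rightarrow> (complex \<Rightarrow> complex) \<Rightarrow> bool"
    (infix "\<prec>\<^sub>D" 50)
  where "g \<prec>\<^sub>D h \<longleftrightarrow> g holomorphic_on \<D> \<and> h holomorphic_on \<D> \<and>
    (\<exists>\<omega>. schwarz_function \<omega> \<and> (\<forall>z\<in>\<D>. g z = h (\<omega> z)))"

(* z f'(z) / f(z) has a removable singularity at 0 when f(0) = 0 and f'(0) = 1, with value 1;
   plain HOL division would give 0 there. At a zero of f other than 0 the quotient below is 0,
   so such an f never satisfies a subordination to an exponential. *)
definition starlike_quotient :: "(complex \<Rightarrow> complex) \<Rightarrow> complex \<Rightarrow> complex"
  where "starlike_quotient f z = (if z = 0 then 1 else z * deriv f z / f z)"

definition starlike_exp :: "real \<Rightarrow> (complex \<Rightarrow> complex) set"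
  where "starlike_exp lam =
    {f \<in> class_A. starlike_quotient f \<prec>\<^sub>D (\<lambda>z. exp (complex_of_real lam * z))}"

definition starlike_exp_at :: "real \<Rightarrow> real \<Rightarrow> (complex \<Rightarrow> complex) set"
  where "starlike_exp_at lam p_hat =
    {f \<in> starlike_exp lam. (deriv ^^ 2) f 0 = complex_of_real p_hat}"

definition sharp_bound :: "'a set \<Rightarrow> ('a \<Rightarrow> real) \<Rightarrow> real \<Rightarrow> bool"
  where "sharp_bound F \<phi> B \<longleftrightarrow>
    (\<forall>f\<in>F. \<phi> f \<le> B) \<and> \<not> (\<exists>M<B. \<forall>f\<in>F. \<phi> f \<le> M)"

definition Phi :: "real \<Rightarrow> real \<Rightarrow> real"
  where "Phi lam p =
    (if p \<le> 8 / (3 * lam)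
     then 1 / 16 * lam * (8 + 8 * p - (3 * lam + 2) * p\<^sup>2)
     else 1 / 16 * lam * (8 - 8 * p + (3 * lam - 2) * p\<^sup>2))"

definition Psi1 :: "real \<Rightarrow> real \<Rightarrow> real"
  where "Psi1 lam p =
    (if p \<le> 2 / (4 - 5 * lam)
     then lam / 1152 * (7 * lam\<^sup>2 * p ^ 3 + (150 * lam\<^sup>2 + 36 * lam - 96) * p\<^sup>2
            + (108 - 360 * lam) * p + 600)
     else lam / 288 * ((- 17 * lam\<^sup>2 + 30 * lam - 12) * p ^ 3 + (54 * lam - 36) * p\<^sup>2
            + (48 - 120 * lam) * p + 144))"

definition Psi2 :: "real \<Rightarrow> real \<Rightarrow> real"
  where "Psi2 lam p =
    (if p \<le> 14 / (4 + 5 * lam)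
     then lam / 1152 * (7 * lam\<^sup>2 * p ^ 3 + (150 * lam\<^sup>2 + 36 * lam - 96) * p\<^sup>2
            + (108 - 360 * lam) * p + 600)
     else lam / 288 * ((- 17 * lam\<^sup>2 - 30 * lam - 12) * p ^ 3 + (54 * lam + 36) * p\<^sup>2
            + (120 * lam + 48) * p - 144))"

end

theory Submission
  imports Defs
begin

text \<open>
  Let \<open>z f'/f = exp (\<lambda> \<omega>)\<close> with a Schwarz function \<open>\<omega>\<close>. Comparing power series expresses
  \<open>a\<^sub>2, a\<^sub>3, a\<^sub>4\<close> as polynomials in the first three coefficients of \<open>\<omega>\<close>
  (\<open>starlike_exp_coeffs\<close>), and conversely every Schwarz function comes from some \<open>f\<close>, obtained by
  integrating \<open>(exp (\<lambda> \<omega>) - 1) / z\<close> (\<open>starlike_exp_function_exists\<close>). The prescribed value of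
  \<open>f''(0)\<close> fixes the first coefficient \<open>c = p/2\<close> of \<open>\<omega>\<close>, a number in \<open>[0, 1]\<close>.

  Two steps of the Schur algorithm show that the triples of initial coefficients of Schwarz functions
  with real first coefficient \<open>c\<close> are exactly
  \<open>c\<close>, \<open>(1 - c\<^sup>2) x\<close>, \<open>(1 - c\<^sup>2) ((1 - |x|\<^sup>2) y - c x\<^sup>2)\<close> with \<open>|x|, |y| \<le> 1\<close>
  (\<open>schwarz_third_coeff\<close>, \<open>schwarz_function_with_coeffs\<close>). Hence
    \<open>a\<^sub>3 - a\<^sub>2 = \<lambda>/2 ((1 - c\<^sup>2) x - (2 c - 3/2 \<lambda> c\<^sup>2))\<close>,
  whose largest modulus is read off at \<open>x = 1\<close> or \<open>x = -1\<close>, and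
    \<open>a\<^sub>4 - a\<^sub>3 = \<lambda>/3 ((1 - c\<^sup>2) ((1 - |x|\<^sup>2) y - c x\<^sup>2 + B x) - E)\<close>,
  where \<open>B = 5/2 \<lambda> c - 3/2\<close> and \<open>E = 9/4 \<lambda> c\<^sup>2 - 17/12 \<lambda>\<^sup>2 c\<^sup>3\<close>.
  Here \<open>E \<ge> 0\<close>, because \<open>\<lambda> c \<le> \<pi>/2 < 27/17\<close>. By the triangle inequality the modulus is at most
  \<open>\<lambda>/3 ((1 - c\<^sup>2) (1 - t\<^sup>2 + c t\<^sup>2 + |B| t) + E)\<close> with \<open>t = |x|\<close>, and equality holds for \<open>y = -1\<close> and real
  \<open>x\<close> with \<open>B x = -|B| t\<close>, since then all terms are nonpositive. The maximum of this quadratic over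
  \<open>[0, 1]\<close> lies at its vertex \<open>t = |B| / (2 (1 - c))\<close> or at \<open>t = 1\<close>, according to whether
  \<open>|B| \<le> 2 (1 - c)\<close>. For \<open>\<lambda> \<le> 3/5\<close> one has \<open>B \<le> 0\<close> throughout, so this inequality becomes
  \<open>p \<le> 2 / (4 - 5 \<lambda>)\<close>; for \<open>\<lambda> > 3/5\<close> it can fail only when \<open>B > 0\<close>, and becomes
  \<open>p \<le> 14 / (4 + 5 \<lambda>)\<close>. These are the case distinctions in \<open>\<Psi>\<^sub>1\<close> and \<open>\<Psi>\<^sub>2\<close>.
\<close>

section \<open>Taylor coefficients on the unit disc\<close>
lemma fps_expansion_taylor_coeff:
  assumes "f holomorphic_on \<D>"
  shows "f has_fps_expansion Abs_fps (taylor_coeff f)"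
proof -
  have "Abs_fps (taylor_coeff f) = fps_expansion f 0"
    by (simp add: fps_eq_iff taylor_coeff_def)
  then show ?thesis
    using has_fps_expansion_fps_expansion[OF open_ball _ assms] by simp
qed

lemma fps_expansion_eq_on_disc:
  fixes f g :: "complex \<Rightarrow> complex"
  assumes "f has_fps_expansion F" "g has_fps_expansion G" "\<And>z. z \<in> \<D> \<Longrightarrow> f z = g z"
  shows "F = G"
proof -
  have "eventually (\<lambda>z. z \<in> \<D>) (nhds (0::complex))"
    by (rule eventually_nhds_in_open) auto
  then have "eventually (\<lambda>z. f z = g z) (nhds 0)"
    by (rule eventually_mono) (use assms(3) in blast)
  then have "g has_fps_expansion F"
    using assms(1) has_fps_expansion_cong by blast
  then show ?thesis
    using assms(2) fps_expansion_unique_complex by blast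
qed

lemma taylor_coeff_0: "taylor_coeff f 0 = f 0"
  and taylor_coeff_1: "taylor_coeff f 1 = deriv f 0"
  by (simp_all add: taylor_coeff_def fps_expansion_def)

lemma taylor_coeff_cong:
  assumes "f holomorphic_on \<D>" "\<And>z. z \<in> \<D> \<Longrightarrow> f z = g z"
  shows "taylor_coeff f n = taylor_coeff g n"
proof -
  have "g holomorphic_on \<D>"
    using assms holomorphic_transform by blast
  then have "Abs_fps (taylor_coeff f) = Abs_fps (taylor_coeff g)"
    using assms by (blast intro: fps_expansion_eq_on_disc fps_expansion_taylor_coeff)
  then show ?thesis by (metis fps_nth_Abs_fps)
qed

lemma taylor_coeff_linear:
  "taylor_coeff (\<lambda>z. a * z) n = (if n = 1 then a else 0)"
proof -
  have "(\<lambda>z. a * z) has_fps_expansion fps_const a * fps_X"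
    by (intro fps_expansion_intros)
  moreover have "(\<lambda>z. a * z) has_fps_expansion Abs_fps (taylor_coeff (\<lambda>z. a * z))"
    by (intro fps_expansion_taylor_coeff holomorphic_intros)
  ultimately have "Abs_fps (taylor_coeff (\<lambda>z. a * z)) = fps_const a * fps_X"
    using fps_expansion_eq_on_disc by blast
  then have "taylor_coeff (\<lambda>z. a * z) n = fps_nth (fps_const a * fps_X) n"
    by (metis fps_nth_Abs_fps)
  then show ?thesis by simp
qed

section \<open>Initial coefficients of Schwarz functions\<close>
lemma schwarz_function_holomorphic: "schwarz_function w \<Longrightarrow> w holomorphic_on \<D>"
  by (simp add: schwarz_function_def)

lemma schwarz_function_bound:
  assumes "schwarz_function w"
  shows "cmod (taylor_coeff w 1) \<le> 1"
  using assms Schwarz_Lemma(2)[of w 0]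
  by (simp add: schwarz_function_def taylor_coeff_1[unfolded One_nat_def])

text \<open>By the equality case of the Schwarz lemma, such a function is a rotation.\<close>
lemma schwarz_function_extremal:
  assumes "schwarz_function w" "cmod (taylor_coeff w 1) = 1" "n \<noteq> 1"
  shows "taylor_coeff w n = 0"
proof -
  obtain a where a: "\<And>z. cmod z < 1 \<Longrightarrow> w z = a * z"
    using assms Schwarz_Lemma(3)[of w 0]
    by (auto simp: schwarz_function_def taylor_coeff_1[unfolded One_nat_def])
  have "taylor_coeff w n = taylor_coeff (\<lambda>z. a * z) n"
    using schwarz_function_holomorphic[OF assms(1)] by (rule taylor_coeff_cong) (simp add: a)
  then show ?thesis using assms(3) by (simp add: taylor_coeff_linear)
qed

lemma schwarz_function_linear:
  assumes "cmod a \<le> 1"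
  shows "schwarz_function (\<lambda>z. a * z)"
  unfolding schwarz_function_def
proof (intro conjI ballI)
  fix z :: complex assume "z \<in> \<D>"
  then show "cmod (a * z) < 1"
    using mult_right_mono[OF assms norm_ge_zero[of z]] by (simp add: norm_mult)
qed (auto intro!: holomorphic_intros)

text \<open>
  One step of the Schur algorithm writes \<open>w = z (c + s) / (1 + c\<^sup>* s)\<close> with \<open>c\<close> the first coefficient of
  \<open>w\<close> and a Schwarz function \<open>s\<close>. The relation is used with the denominator cleared, so that the
  coefficients of \<open>w\<close> follow recursively from a product of power series.
\<close>
lemma schur_step_coeffs:
  assumes w: "w holomorphic_on \<D>" and s: "schwarz_function s"
    and step: "\<forall>z\<in>\<D>. w z * (1 + cnj c * s z) = z * (c + s z)"
  shows "taylor_coeff w 1 = c"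
    and "taylor_coeff w 2 = (1 - (cmod c)\<^sup>2) * taylor_coeff s 1"
    and "taylor_coeff w 3 = (1 - (cmod c)\<^sup>2) * (taylor_coeff s 2 - cnj c * (taylor_coeff s 1)\<^sup>2)"
proof -
  let ?W = "Abs_fps (taylor_coeff w)" and ?S = "Abs_fps (taylor_coeff s)"
  have s0: "taylor_coeff s 0 = 0"
    using s by (simp add: taylor_coeff_0 schwarz_function_def)
  have "?W * (1 + fps_const (cnj c) * ?S) = fps_X * (fps_const c + ?S)"
  proof (rule fps_expansion_eq_on_disc)
    show "(\<lambda>z. w z * (1 + cnj c * s z)) has_fps_expansion ?W * (1 + fps_const (cnj c) * ?S)"
      using w s unfolding schwarz_function_def
      by (intro fps_expansion_intros fps_expansion_taylor_coeff) auto
    show "(\<lambda>z. z * (c + s z)) has_fps_expansion fps_X * (fps_const c + ?S)"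
      using s unfolding schwarz_function_def
      by (intro fps_expansion_intros fps_expansion_taylor_coeff) auto
  qed (use step in auto)
  then have eq: "fps_nth (?W * (1 + fps_const (cnj c) * ?S)) n = fps_nth (fps_X * (fps_const c + ?S)) n" for n
    by simp
  have w0: "taylor_coeff w 0 = 0"
    using eq[of 0] by (simp add: s0)
  have w1: "taylor_coeff w 1 = c"
    using eq[of 1] by (simp add: fps_mult_nth s0 w0)
  show "taylor_coeff w 1 = c" by (rule w1)
  have w2: "taylor_coeff w 2 + c * (cnj c * taylor_coeff s 1) = taylor_coeff s 1"
    using eq[of 2] w1 by (simp add: fps_mult_nth s0 w0 eval_nat_numeral add_ac)
  have cc: "complex_of_real (1 - (cmod c)\<^sup>2) = 1 - c * cnj c"
    by (simp only: of_real_diff of_real_1 complex_norm_square)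
  show w2': "taylor_coeff w 2 = (1 - (cmod c)\<^sup>2) * taylor_coeff s 1"
    using w2 unfolding cc by (simp add: algebra_simps)
  have w3: "taylor_coeff w 3 + taylor_coeff w 2 * (cnj c * taylor_coeff s 1)
      + c * (cnj c * taylor_coeff s 2) = taylor_coeff s 2"
    using eq[of 3] w1 by (simp add: fps_mult_nth s0 w0 eval_nat_numeral algebra_simps)
  then show "taylor_coeff w 3 = (1 - (cmod c)\<^sup>2) * (taylor_coeff s 2 - cnj c * (taylor_coeff s 1)\<^sup>2)"
    unfolding w2' cc by (simp add: algebra_simps power2_eq_square)
qed

text \<open>
  For \<open>|c| \<le> 1\<close> the Moebius map \<open>u \<mapsto> (c + u) / (1 + c\<^sup>* u)\<close> sends the open disc into the closed disc,
  and into the open disc if \<open>|c| < 1\<close>.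
\<close>
lemma moebius_nonzero:
  assumes "cmod c \<le> 1" "cmod u < 1"
  shows "1 + cnj c * u \<noteq> 0"
proof
  assume "1 + cnj c * u = 0"
  then have "cnj c * u = - 1" by (simp add: add_eq_0_iff)
  then have "cmod c * cmod u = 1" by (metis complex_mod_cnj norm_minus_cancel norm_mult norm_one)
  moreover have "cmod c * cmod u \<le> cmod u"
    using mult_right_mono[OF assms(1) norm_ge_zero[of u]] by simp
  ultimately show False using assms by simp
qed

lemma moebius_norm_identity:
  "(cmod (1 + cnj c * u))\<^sup>2 - (cmod (c + u))\<^sup>2 = (1 - (cmod c)\<^sup>2) * (1 - (cmod u)\<^sup>2)"
  unfolding cmod_power2 by (simp add: algebra_simps power2_eq_square)

lemma moebius_norm_le:
  assumes "cmod c \<le> 1" "cmod u < 1"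
  shows "cmod (c + u) \<le> cmod (1 + cnj c * u)"
proof -
  have "0 \<le> (1 - (cmod c)\<^sup>2) * (1 - (cmod u)\<^sup>2)"
    using assms by (intro mult_nonneg_nonneg) (auto simp: power_le_one)
  then have "(cmod (c + u))\<^sup>2 \<le> (cmod (1 + cnj c * u))\<^sup>2"
    using moebius_norm_identity[of c u] by linarith
  then show ?thesis by (rule power2_le_imp_le) simp
qed

lemma moebius_norm_less:
  assumes "cmod c < 1" "cmod u < 1"
  shows "cmod (c + u) < cmod (1 + cnj c * u)"
proof -
  have "0 < (1 - (cmod c)\<^sup>2) * (1 - (cmod u)\<^sup>2)"
    using assms by (intro mult_pos_pos) (auto simp: power_less_one_iff)
  then have "(cmod (c + u))\<^sup>2 < (cmod (1 + cnj c * u))\<^sup>2"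
    using moebius_norm_identity[of c u] by linarith
  then show ?thesis by (rule power2_less_imp_less) simp
qed

text \<open>
  Admitting \<open>|c| = 1\<close>, where the quotient degenerates to \<open>c z\<close>, lets the extremal coefficient triples be
  realised in the same way as the generic ones.
\<close>
lemma schur_step_converse:
  assumes c: "cmod c \<le> 1" and s: "schwarz_function s"
  obtains w where "schwarz_function w"
    and "\<forall>z\<in>\<D>. w z * (1 + cnj c * s z) = z * (c + s z)"
proof
  let ?w = "\<lambda>z. z * (c + s z) / (1 + cnj c * s z)"
  have nz: "1 + cnj c * s z \<noteq> 0" if "z \<in> \<D>" for z
    using moebius_nonzero[OF c] s that by (simp add: schwarz_function_def)
  show "schwarz_function ?w"
    unfolding schwarz_function_def
  proof (intro conjI ballI)
    show "?w holomorphic_on \<D>"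
      using s nz unfolding schwarz_function_def by (auto intro!: holomorphic_intros)
    fix z assume z: "z \<in> \<D>"
    have "cmod (c + s z) / cmod (1 + cnj c * s z) \<le> 1"
      using moebius_norm_le[OF c, of "s z"] s z nz[OF z]
      by (simp add: schwarz_function_def)
    then have "cmod z * (cmod (c + s z) / cmod (1 + cnj c * s z)) \<le> cmod z * 1"
      by (intro mult_left_mono) auto
    also have "\<dots> < 1" using z by simp
    finally show "cmod (?w z) < 1"
      by (simp add: norm_mult norm_divide)
  qed simp
  show "\<forall>z\<in>\<D>. ?w z * (1 + cnj c * s z) = z * (c + s z)"
    using nz by simp
qed

text \<open>
  The quotient \<open>h = w / z\<close> has \<open>h(0) = c\<close>, and the equality case of the Schwarz lemma, which would force
  \<open>|c| = 1\<close>, is the only obstacle to \<open>|h| < 1\<close>. The Moebius map taking \<open>c\<close> to \<open>0\<close> then turns \<open>h\<close> into a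
  Schwarz function.
\<close>
lemma schur_step:
  assumes w: "schwarz_function w" and c: "c = taylor_coeff w 1" and c1: "cmod c < 1"
  obtains s where "schwarz_function s"
    and "\<forall>z\<in>\<D>. w z * (1 + cnj c * s z) = z * (c + s z)"
proof -
  have c': "c = deriv w 0" unfolding c by (rule taylor_coeff_1)
  obtain h where h: "h holomorphic_on \<D>" and wh: "\<And>z. cmod z < 1 \<Longrightarrow> w z = z * h z"
    and h0: "deriv w 0 = h 0"
    using Schwarz3[of w] w by (auto simp: schwarz_function_def)
  have hlt: "cmod (h z) < 1" if z: "z \<in> \<D>" for z
  proof (cases "z = 0")
    case True
    then show ?thesis using c1 c' h0 by simp
  next
    case False
    have "cmod (w z) \<noteq> cmod z"
    proof
      assume "cmod (w z) = cmod z"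
      then obtain a where a: "\<And>z. cmod z < 1 \<Longrightarrow> w z = a * z" "cmod a = 1"
        using Schwarz_Lemma(3)[of w 0] w False z by (auto simp: schwarz_function_def)
      have "taylor_coeff w 1 = taylor_coeff (\<lambda>z. a * z) 1"
        using schwarz_function_holomorphic[OF w] by (rule taylor_coeff_cong) (simp add: a)
      then show False using a c1 c by (simp add: taylor_coeff_linear)
    qed
    moreover have "cmod (w z) \<le> cmod z"
      using Schwarz_Lemma(1)[of w z] w z by (auto simp: schwarz_function_def)
    ultimately show ?thesis
      using wh[of z] z False by (simp add: norm_mult)
  qed
  let ?s = "\<lambda>z. (h z - c) / (1 - cnj c * h z)"
  have nz: "1 - cnj c * h z \<noteq> 0" if "z \<in> \<D>" for z
    using moebius_nonzero[of "-c" "h z"] hlt[OF that] c1 by simp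
  have "schwarz_function ?s"
    unfolding schwarz_function_def
  proof (intro conjI ballI)
    show "?s holomorphic_on \<D>"
      using h nz by (auto intro!: holomorphic_intros)
    show "?s 0 = 0" using c' h0 by simp
    fix z assume z: "z \<in> \<D>"
    have "cmod (h z - c) < cmod (1 - cnj c * h z)"
      using moebius_norm_less[of "-c" "h z"] hlt[OF z] c1 by simp
    then show "cmod (?s z) < 1"
      using nz[OF z] by (simp add: norm_divide)
  qed
  moreover have "w z * (1 + cnj c * ?s z) = z * (c + ?s z)" if z: "z \<in> \<D>" for z
  proof -
    have "h z * (1 + cnj c * ?s z) = c + ?s z"
      using nz[OF z] by (simp add: divide_simps) (simp add: algebra_simps)
    then show ?thesis using wh[of z] z by (simp add: mult.assoc)
  qed
  ultimately show ?thesis using that[of ?s] by blast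
qed

text \<open>
  This is the Schwarz-Pick bound at the origin: \<open>y\<close> is the first coefficient after one Schur step,
  which is possible unless \<open>s\<close> is a rotation.
\<close>
lemma schwarz_second_coeff:
  assumes s: "schwarz_function s"
  obtains y :: complex where "cmod y \<le> 1" "taylor_coeff s 2 = (1 - (cmod (taylor_coeff s 1))\<^sup>2) * y"
proof (cases "cmod (taylor_coeff s 1) = 1")
  case True
  then have "taylor_coeff s 2 = 0"
    by (rule schwarz_function_extremal[OF s]) simp
  then show ?thesis using that[of 0] by simp
next
  case False
  then have "cmod (taylor_coeff s 1) < 1"
    using schwarz_function_bound[OF s] by linarith
  from schur_step[OF s refl this] obtain r where r: "schwarz_function r"
    "\<forall>z\<in>\<D>. s z * (1 + cnj (taylor_coeff s 1) * r z) = z * (taylor_coeff s 1 + r z)"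
    by blast
  show ?thesis
    by (rule that[OF schwarz_function_bound[OF r(1)]])
      (rule schur_step_coeffs(2)[OF schwarz_function_holomorphic[OF s] r])
qed

text \<open>
  Unless \<open>w\<close> is a rotation, a Schur step leads to a function whose first coefficient is \<open>x\<close> and whose
  second coefficient provides \<open>y\<close>.
\<close>
lemma schwarz_third_coeff:
  assumes w: "schwarz_function w" and c: "c = taylor_coeff w 1"
  obtains x y :: complex where "cmod x \<le> 1" "cmod y \<le> 1"
    "taylor_coeff w 2 = (1 - (cmod c)\<^sup>2) * x"
    "taylor_coeff w 3 = (1 - (cmod c)\<^sup>2) * ((1 - (cmod x)\<^sup>2) * y - cnj c * x\<^sup>2)"
proof (cases "cmod c = 1")
  case True
  then have "taylor_coeff w 2 = 0" "taylor_coeff w 3 = 0"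
    unfolding c by (auto intro: schwarz_function_extremal[OF w])
  then show ?thesis using that[of 0 0] True by simp
next
  case False
  then have "cmod c < 1"
    using schwarz_function_bound[OF w] unfolding c by linarith
  from schur_step[OF w c this] obtain s where s: "schwarz_function s"
    "\<forall>z\<in>\<D>. w z * (1 + cnj c * s z) = z * (c + s z)"
    by blast
  obtain y :: complex where y: "cmod y \<le> 1" "taylor_coeff s 2 = (1 - (cmod (taylor_coeff s 1))\<^sup>2) * y"
    by (rule schwarz_second_coeff[OF s(1)])
  note wc = schur_step_coeffs[OF schwarz_function_holomorphic[OF w] s]
  have "taylor_coeff w 3 = (1 - (cmod c)\<^sup>2) *
      ((1 - (cmod (taylor_coeff s 1))\<^sup>2) * y - cnj c * (taylor_coeff s 1)\<^sup>2)"
    using wc(3) unfolding y(2) .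
  with schwarz_function_bound[OF s(1)] y(1) wc(2) show ?thesis
    by (rule that)
qed

text \<open>Conversely, two Schur steps run backwards from the linear function \<open>y z\<close> reach every such triple.\<close>
lemma schwarz_function_with_coeffs:
  fixes c x y :: complex
  assumes "cmod c \<le> 1" "cmod x \<le> 1" "cmod y \<le> 1"
  obtains w where "schwarz_function w" "taylor_coeff w 1 = c"
    "taylor_coeff w 2 = (1 - (cmod c)\<^sup>2) * x"
    "taylor_coeff w 3 = (1 - (cmod c)\<^sup>2) * ((1 - (cmod x)\<^sup>2) * y - cnj c * x\<^sup>2)"
proof -
  have y: "schwarz_function (\<lambda>z. y * z)" by (rule schwarz_function_linear[OF assms(3)])
  from schur_step_converse[OF assms(2) y] obtain s where s: "schwarz_function s"
    "\<forall>z\<in>\<D>. s z * (1 + cnj x * (y * z)) = z * (x + y * z)"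
    by blast
  from schur_step_converse[OF assms(1) s(1)] obtain w where w: "schwarz_function w"
    "\<forall>z\<in>\<D>. w z * (1 + cnj c * s z) = z * (c + s z)"
    by blast
  note wc = schur_step_coeffs[OF schwarz_function_holomorphic[OF w(1)] s(1) w(2)]
  note sc = schur_step_coeffs[OF schwarz_function_holomorphic[OF s(1)] y s(2)]
  have s2: "taylor_coeff s 2 = (1 - (cmod x)\<^sup>2) * y"
    using sc(2) unfolding taylor_coeff_linear by simp
  have "taylor_coeff w 2 = (1 - (cmod c)\<^sup>2) * x"
    "taylor_coeff w 3 = (1 - (cmod c)\<^sup>2) * ((1 - (cmod x)\<^sup>2) * y - cnj c * x\<^sup>2)"
    using wc(2,3) unfolding sc(1) s2 by simp_all
  with w(1) wc(1) show ?thesis by (rule that)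
qed

section \<open>From Schwarz functions to starlike functions\<close>
lemma class_A_iff: "f \<in> class_A \<longleftrightarrow> f holomorphic_on \<D> \<and> f 0 = 0 \<and> deriv f 0 = 1"
proof (cases "f holomorphic_on \<D>")
  case True
  let ?a = "taylor_coeff f"
  have *: "(\<lambda>n. ?a (n + 2) * z ^ (n + 2)) sums (f z - (f 0 + deriv f 0 * z))" if "z \<in> \<D>" for z
  proof -
    have "(\<lambda>n. ?a n * z ^ n) sums f z"
      using holomorphic_power_series[OF True that] by (simp add: taylor_coeff_def fps_expansion_def)
    from sums_split_initial_segment[OF this, of 2] show ?thesis
      by (simp add: numeral_2_eq_2 taylor_coeff_0 taylor_coeff_1[unfolded One_nat_def])
  qed
  show ?thesis
  proof
    assume "f \<in> class_A"
    then have eq: "f 0 + deriv f 0 * z = z" if "z \<in> \<D>" for z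
    proof -
      have "f z - (f 0 + deriv f 0 * z) = f z - z"
        using \<open>f \<in> class_A\<close> that by (intro sums_unique2[OF *]) (auto simp: class_A_def)
      then show ?thesis by (simp add: diff_eq_eq)
    qed
    then have "f 0 = 0" using eq[of 0] by simp
    moreover have "deriv f 0 = 1" using eq[of "1/2"] \<open>f 0 = 0\<close> by simp
    ultimately show "f holomorphic_on \<D> \<and> f 0 = 0 \<and> deriv f 0 = 1" using True by blast
  next
    assume "f holomorphic_on \<D> \<and> f 0 = 0 \<and> deriv f 0 = 1"
    then show "f \<in> class_A" using * by (auto simp: class_A_def)
  qed
qed (simp add: class_A_def)

text \<open>
  Clearing the denominator of \<open>z f'/f\<close> gives an identity of power series. The subordination also implies
  that \<open>f\<close> vanishes only at the origin, as the exponential has no zeros.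
\<close>
lemma starlike_exp_ode_iff:
  assumes f: "f \<in> class_A" and w: "schwarz_function w"
  shows "(\<forall>z\<in>\<D>. starlike_quotient f z = exp (complex_of_real lam * w z)) \<longleftrightarrow>
    (\<forall>z\<in>\<D>. z * deriv f z = f z * exp (complex_of_real lam * w z)) \<and> (\<forall>z\<in>\<D>. z \<noteq> 0 \<longrightarrow> f z \<noteq> 0)"
    (is "?L \<longleftrightarrow> ?R")
proof
  assume ?L
  then have q: "starlike_quotient f z = exp (complex_of_real lam * w z)" if "z \<in> \<D>" for z
    using that by blast
  have nz: "f z \<noteq> 0" if "z \<in> \<D>" "z \<noteq> 0" for z
    using q[OF that(1)] that(2) by (auto simp: starlike_quotient_def)
  have "z * deriv f z = f z * exp (complex_of_real lam * w z)" if z: "z \<in> \<D>" for z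
  proof (cases "z = 0")
    case True
    then show ?thesis using f by (simp add: class_A_iff)
  next
    case False
    then show ?thesis
      using q[OF z] nz[OF z] by (simp add: starlike_quotient_def field_simps)
  qed
  then show ?R using nz by blast
next
  assume ?R
  then show ?L
    using w by (auto simp: starlike_quotient_def schwarz_function_def)
qed

text \<open>
  The function \<open>q = exp (\<lambda> \<omega>)\<close> solves \<open>q' = \<lambda> \<omega>' q\<close>, which determines its coefficients recursively;
  those of \<open>f\<close> then follow recursively from \<open>z f' = f q\<close>.
\<close>
lemma starlike_exp_coeffs:
  fixes lam :: real and f w :: "complex \<Rightarrow> complex"
  assumes f: "f \<in> class_A" and w: "schwarz_function w"
    and ode: "\<forall>z\<in>\<D>. z * deriv f z = f z * exp (complex_of_real lam * w z)"
  shows "taylor_coeff f 2 = lam * taylor_coeff w 1"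
    and "taylor_coeff f 3 = lam / 2 * taylor_coeff w 2 + 3 / 4 * lam\<^sup>2 * (taylor_coeff w 1)\<^sup>2"
    and "taylor_coeff f 4 = lam / 3 * (taylor_coeff w 3 + 5 / 2 * lam * taylor_coeff w 1 * taylor_coeff w 2
      + 17 / 12 * lam\<^sup>2 * (taylor_coeff w 1) ^ 3)"
proof -
  define q where "q = (\<lambda>z. exp (complex_of_real lam * w z))"
  let ?F = "Abs_fps (taylor_coeff f)" and ?W = "Abs_fps (taylor_coeff w)" and ?Q = "Abs_fps (taylor_coeff q)"
  have hf: "f holomorphic_on \<D>" using f by (simp add: class_A_iff)
  have hw: "w holomorphic_on \<D>" and w0: "w 0 = 0" using w by (simp_all add: schwarz_function_def)
  have hq: "q holomorphic_on \<D>" unfolding q_def by (intro holomorphic_intros hw)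
  note ex = fps_expansion_taylor_coeff
  have dq: "deriv q z = lam * deriv w z * q z" if "z \<in> \<D>" for z
  proof -
    have "(w has_field_derivative deriv w z) (at z)"
      using hw that holomorphic_derivI[OF hw open_ball] by blast
    then have "(q has_field_derivative (lam * deriv w z * q z)) (at z)"
      unfolding q_def by (auto intro!: derivative_eq_intros)
    then show ?thesis by (rule DERIV_imp_deriv)
  qed
  have "fps_deriv ?Q = fps_const (complex_of_real lam) * fps_deriv ?W * ?Q"
    by (rule fps_expansion_eq_on_disc[where f = "deriv q" and g = "\<lambda>z. lam * deriv w z * q z"])
      (auto intro!: fps_expansion_intros ex hq hw simp: dq)
  then have Q: "fps_nth (fps_deriv ?Q) n = fps_nth (fps_const (complex_of_real lam) * fps_deriv ?W * ?Q) n" for n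
    by simp
  have ode_q: "z * deriv f z = f z * q z" if "z \<in> \<D>" for z
    using ode that by (simp add: q_def)
  have "fps_X * fps_deriv ?F = ?F * ?Q"
    by (rule fps_expansion_eq_on_disc[where f = "\<lambda>z. z * deriv f z" and g = "\<lambda>z. f z * q z"])
      (auto intro!: fps_expansion_intros ex hf hq simp: ode_q)
  then have F: "fps_nth (fps_X * fps_deriv ?F) n = fps_nth (?F * ?Q) n" for n
    by simp
  have a0: "taylor_coeff f 0 = 0" "taylor_coeff f 1 = 1"
    using f by (simp_all only: taylor_coeff_0 taylor_coeff_1 class_A_iff)
  have W0: "taylor_coeff w 0 = 0" and Q0: "taylor_coeff q 0 = 1"
    by (simp_all add: taylor_coeff_0 w0 q_def)
  have Q1: "taylor_coeff q 1 = lam * taylor_coeff w 1"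
    using Q[of 0] by (simp add: Q0)
  have Q2: "2 * taylor_coeff q 2 = lam * (2 * taylor_coeff w 2 + taylor_coeff w 1 * taylor_coeff q 1)"
    using Q[of 1] by (simp add: fps_mult_nth Q0 eval_nat_numeral algebra_simps)
  have Q3: "3 * taylor_coeff q 3 = lam * (3 * taylor_coeff w 3 + 2 * taylor_coeff w 2 * taylor_coeff q 1
      + taylor_coeff w 1 * taylor_coeff q 2)"
    using Q[of 2] by (simp add: fps_mult_nth Q0 eval_nat_numeral algebra_simps)
  have a2: "2 * taylor_coeff f 2 = taylor_coeff q 1 + taylor_coeff f 2"
    using F[of 2] a0 by (simp add: fps_mult_nth Q0 eval_nat_numeral algebra_simps)
  have a3: "3 * taylor_coeff f 3 = taylor_coeff q 2 + taylor_coeff f 2 * taylor_coeff q 1 + taylor_coeff f 3"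
    using F[of 3] a0 by (simp add: fps_mult_nth Q0 eval_nat_numeral algebra_simps)
  have a4: "4 * taylor_coeff f 4 = taylor_coeff q 3 + taylor_coeff f 2 * taylor_coeff q 2
      + taylor_coeff f 3 * taylor_coeff q 1 + taylor_coeff f 4"
    using F[of 4] a0 by (simp add: fps_mult_nth Q0 eval_nat_numeral algebra_simps)
  have a4': "taylor_coeff f 4 = (taylor_coeff q 3 + taylor_coeff f 2 * taylor_coeff q 2
      + taylor_coeff f 3 * taylor_coeff q 1) / 3"
    using a4 by (simp add: field_simps)
  show a2': "taylor_coeff f 2 = lam * taylor_coeff w 1"
    using a2 Q1 by simp
  have Q2': "taylor_coeff q 2 = lam * taylor_coeff w 2 + lam\<^sup>2 * (taylor_coeff w 1)\<^sup>2 / 2"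
    using Q2 unfolding Q1 by (simp add: field_simps power2_eq_square)
  have Q3': "taylor_coeff q 3 = lam * taylor_coeff w 3 + lam\<^sup>2 * taylor_coeff w 1 * taylor_coeff w 2
      + lam ^ 3 * (taylor_coeff w 1) ^ 3 / 6"
    using Q3 unfolding Q1 Q2' by (simp add: field_simps power2_eq_square power3_eq_cube)
  show a3': "taylor_coeff f 3 = lam / 2 * taylor_coeff w 2 + 3 / 4 * lam\<^sup>2 * (taylor_coeff w 1)\<^sup>2"
    using a3 unfolding Q1 Q2' a2' by (simp add: field_simps power2_eq_square)
  show "taylor_coeff f 4 = lam / 3 * (taylor_coeff w 3 + 5 / 2 * lam * taylor_coeff w 1 * taylor_coeff w 2
      + 17 / 12 * lam\<^sup>2 * (taylor_coeff w 1) ^ 3)"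
    unfolding a4' Q1 Q2' Q3' a2' a3' by (simp add: field_simps power2_eq_square power3_eq_cube)
qed

text \<open>
  With \<open>q = exp (\<lambda> \<omega>)\<close> and a primitive \<open>G\<close> of the holomorphic function \<open>(q - 1) / z\<close>, the function
  \<open>f = z exp (G - G(0))\<close> satisfies \<open>f' = q exp (G - G(0))\<close>.
\<close>
lemma starlike_exp_function_exists:
  fixes lam :: real and w :: "complex \<Rightarrow> complex"
  assumes w: "schwarz_function w"
  obtains f :: "complex \<Rightarrow> complex" where "f \<in> starlike_exp lam" "\<forall>z\<in>\<D>. z * deriv f z = f z * exp (lam * w z)"
proof -
  define q where "q = (\<lambda>z. exp (complex_of_real lam * w z))"
  have hw: "w holomorphic_on \<D>" and w0: "w 0 = 0" using w by (simp_all add: schwarz_function_def)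
  have hq: "q holomorphic_on \<D>" unfolding q_def by (intro holomorphic_intros hw)
  have "(\<lambda>z. q z - 1) holomorphic_on \<D>" by (intro holomorphic_intros hq)
  moreover have "q 0 - 1 = 0" by (simp add: q_def w0)
  ultimately obtain g where g: "g holomorphic_on \<D>" "\<And>z. cmod z < 1 \<Longrightarrow> q z - 1 = z * g z"
    by (rule Schwarz3) blast
  obtain G where "\<And>z. z \<in> \<D> \<Longrightarrow> (G has_field_derivative g z) (at z within \<D>)"
    using holomorphic_convex_primitive'[OF convex_ball open_ball g(1)] by blast
  then have G: "(G has_field_derivative g z) (at z)" if "z \<in> \<D>" for z
    using that at_within_open[OF that open_ball] by metis
  define f where "f = (\<lambda>z. z * exp (G z - G 0))"
  have df: "(f has_field_derivative q z * exp (G z - G 0)) (at z)" if z: "z \<in> \<D>" for z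
  proof -
    have "(f has_field_derivative exp (G z - G 0) + z * (g z * exp (G z - G 0))) (at z)"
      unfolding f_def using G[OF z] by (auto intro!: derivative_eq_intros)
    moreover have "q z = 1 + z * g z"
      using g(2)[of z] z by (simp add: algebra_simps)
    ultimately show ?thesis by (simp add: algebra_simps)
  qed
  have "f holomorphic_on \<D>"
    by (rule holomorphic_onI) (meson df field_differentiable_at_within field_differentiable_def)
  moreover have "deriv f 0 = 1"
    using DERIV_imp_deriv[OF df[of 0]] w0 by (simp add: q_def)
  ultimately have fA: "f \<in> class_A"
    by (simp add: class_A_iff f_def)
  have ode: "\<forall>z\<in>\<D>. z * deriv f z = f z * exp (lam * w z)"
    using DERIV_imp_deriv[OF df] by (simp add: q_def f_def)
  then have sq: "\<forall>z\<in>\<D>. starlike_quotient f z = exp (lam * w z)"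
    using starlike_exp_ode_iff[OF fA w, of lam] by (auto simp: f_def)
  have "starlike_quotient f holomorphic_on \<D>"
    using hq by (rule holomorphic_transform) (simp add: sq q_def)
  then have "starlike_quotient f \<prec>\<^sub>D (\<lambda>z. exp (complex_of_real lam * z))"
    unfolding subordinate_def using w sq by (auto intro!: holomorphic_intros)
  then show ?thesis
    using that[of f] fA ode by (simp add: starlike_exp_def)
qed

text \<open>
  The coefficient parametrisation of Schwarz functions now carries over to the class. The second
  derivative is written as \<open>2 \<lambda> c\<close>, so that \<open>c\<close> is the first coefficient of the Schwarz function.
\<close>
lemma starlike_exp_at_coeffs:
  assumes lam: "0 < lam" and f: "f \<in> starlike_exp_at lam (2 * lam * c)"
  obtains x y :: complex where "cmod x \<le> 1" "cmod y \<le> 1"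
    "taylor_coeff f 2 = lam * c"
    "taylor_coeff f 3 = lam / 2 * (1 - c\<^sup>2) * x + 3 / 4 * lam\<^sup>2 * c\<^sup>2"
    "taylor_coeff f 4 = lam / 3 * ((1 - c\<^sup>2) * ((1 - (cmod x)\<^sup>2) * y - c * x\<^sup>2 + 5 / 2 * lam * c * x)
      + 17 / 12 * lam\<^sup>2 * c ^ 3)"
proof -
  obtain w where w: "schwarz_function w" and fA: "f \<in> class_A"
    and "\<forall>z\<in>\<D>. starlike_quotient f z = exp (complex_of_real lam * w z)"
    using f by (auto simp: starlike_exp_at_def starlike_exp_def subordinate_def)
  then have ode: "\<forall>z\<in>\<D>. z * deriv f z = f z * exp (complex_of_real lam * w z)"
    using starlike_exp_ode_iff by blast
  note fc = starlike_exp_coeffs[OF fA w ode]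
  have f2: "taylor_coeff f 2 = complex_of_real lam * complex_of_real c"
    using f by (simp add: starlike_exp_at_def taylor_coeff_def fps_expansion_def fact_2)
  then have c: "complex_of_real c = taylor_coeff w 1"
    using fc(1) lam by simp
  obtain x y :: complex where xy: "cmod x \<le> 1" "cmod y \<le> 1"
    "taylor_coeff w 2 = (1 - (cmod c)\<^sup>2) * x"
    "taylor_coeff w 3 = (1 - (cmod c)\<^sup>2) * ((1 - (cmod x)\<^sup>2) * y - cnj c * x\<^sup>2)"
    by (rule schwarz_third_coeff[OF w c])
  show ?thesis
    by (rule that[OF xy(1,2) f2])
      (simp_all add: fc xy(3,4) c[unfolded One_nat_def, symmetric] norm_of_real field_simps power2_eq_square power3_eq_cube)
qed

text \<open>Real parameters suffice here, since all extremal functions have real coefficients.\<close>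
lemma starlike_exp_at_with_coeffs:
  fixes lam c x y :: real
  assumes "\<bar>c\<bar> \<le> 1" "\<bar>x\<bar> \<le> 1" "\<bar>y\<bar> \<le> 1"
  obtains f where "f \<in> starlike_exp_at lam (2 * lam * c)"
    "taylor_coeff f 2 = lam * c"
    "taylor_coeff f 3 = lam / 2 * (1 - c\<^sup>2) * x + 3 / 4 * lam\<^sup>2 * c\<^sup>2"
    "taylor_coeff f 4 = lam / 3 * ((1 - c\<^sup>2) * ((1 - x\<^sup>2) * y - c * x\<^sup>2 + 5 / 2 * lam * c * x)
      + 17 / 12 * lam\<^sup>2 * c ^ 3)"
proof -
  obtain w where w: "schwarz_function w" "taylor_coeff w 1 = c"
    "taylor_coeff w 2 = (1 - (cmod c)\<^sup>2) * complex_of_real x"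
    "taylor_coeff w 3 = (1 - (cmod c)\<^sup>2) * ((1 - (cmod x)\<^sup>2) * complex_of_real y - cnj c * (complex_of_real x)\<^sup>2)"
    by (rule schwarz_function_with_coeffs[of c x y]) (use assms in auto)
  obtain f :: "complex \<Rightarrow> complex" where f: "f \<in> starlike_exp lam" "\<forall>z\<in>\<D>. z * deriv f z = f z * exp (complex_of_real lam * w z)"
    by (rule starlike_exp_function_exists[OF w(1)])
  then have "f \<in> class_A" by (simp add: starlike_exp_def)
  note fc = starlike_exp_coeffs[OF this w(1) f(2)]
  have f2: "taylor_coeff f 2 = lam * c" using fc(1) w(2) by simp
  then have "f \<in> starlike_exp_at lam (2 * lam * c)"
    using f(1) by (simp add: starlike_exp_at_def taylor_coeff_def fps_expansion_def fact_2)
  then show ?thesis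
    by (rule that[OF _ f2])
      (simp_all add: fc w(2-4)[unfolded One_nat_def] field_simps power2_eq_square power3_eq_cube)
qed

section \<open>The extremal problem in the parameters\<close>
lemma sharp_boundI:
  assumes "\<And>f. f \<in> F \<Longrightarrow> \<phi> f \<le> B" and "\<exists>f\<in>F. \<phi> f = B"
  shows "sharp_bound F \<phi> B"
  using assms unfolding sharp_bound_def by force

text \<open>
  The maximum of \<open>1 - t\<^sup>2 + c t\<^sup>2 + |B| t\<close> over \<open>0 \<le> t \<le> 1\<close>, attained at the vertex in the first case and
  at \<open>t = 1\<close> in the second. For \<open>c = 1\<close> the first case means \<open>B = 0\<close>, and the quotient \<open>0/0 = 0\<close> gives the
  correct value \<open>1\<close>.
\<close>
definition disc_max :: "real \<Rightarrow> real \<Rightarrow> real" where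
  "disc_max c B = (if \<bar>B\<bar> \<le> 2 * (1 - c) then 1 + B\<^sup>2 / (4 * (1 - c)) else c + \<bar>B\<bar>)"

text \<open>The factor \<open>1 - c\<^sup>2\<close> cancels the denominator, leaving a polynomial that also covers \<open>c = 1\<close>.\<close>
lemma disc_max_interior:
  assumes "c \<le> 1" "\<bar>B\<bar> \<le> 2 * (1 - c)"
  shows "(1 - c\<^sup>2) * disc_max c B = 1 - c\<^sup>2 + B\<^sup>2 * (1 + c) / 4"
proof (cases "c = 1")
  case True
  then show ?thesis using assms by simp
next
  case False
  then have A: "(1 - c\<^sup>2) / (4 * (1 - c)) = (1 + c) / 4"
    by (simp add: field_simps power2_eq_square)
  have "(1 - c\<^sup>2) * disc_max c B = 1 - c\<^sup>2 + B\<^sup>2 * ((1 - c\<^sup>2) / (4 * (1 - c)))"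
    using assms by (simp add: disc_max_def distrib_left mult.commute)
  then show ?thesis unfolding A by simp
qed

lemma disc_quadratic_le:
  fixes c B t :: real
  assumes c: "c \<le> 1" and t: "0 \<le> t" "t \<le> 1"
  shows "1 - t\<^sup>2 + c * t\<^sup>2 + \<bar>B\<bar> * t \<le> disc_max c B"
proof (cases "\<bar>B\<bar> \<le> 2 * (1 - c)")
  case True
  show ?thesis
  proof (cases "c = 1")
    case c1: True
    then show ?thesis using True by (simp add: disc_max_def)
  next
    case False
    then have "0 < 1 - c" using c by simp
    \<comment> \<open>completing the square\<close>
    moreover have "(\<bar>B\<bar> * t - (1 - c) * t\<^sup>2) * (4 * (1 - c)) = B\<^sup>2 - (2 * (1 - c) * t - \<bar>B\<bar>)\<^sup>2"
      by (simp add: power2_eq_square algebra_simps)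
    then have "(\<bar>B\<bar> * t - (1 - c) * t\<^sup>2) * (4 * (1 - c)) \<le> B\<^sup>2" by simp
    ultimately have "\<bar>B\<bar> * t - (1 - c) * t\<^sup>2 \<le> B\<^sup>2 / (4 * (1 - c))"
      by (subst pos_le_divide_eq) simp_all
    moreover have "disc_max c B = 1 + B\<^sup>2 / (4 * (1 - c))"
      using True by (simp add: disc_max_def)
    ultimately show ?thesis by (simp add: left_diff_distrib)
  qed
next
  case False
  \<comment> \<open>the value at 1 minus the value at \<open>t\<close> is \<open>(1 - t) (|B| - (1 - c) (1 + t))\<close>\<close>
  have "(1 - c) * (1 + t) \<le> (1 - c) * 2"
    using c t by (intro mult_left_mono) auto
  then have "0 \<le> (1 - t) * (\<bar>B\<bar> - (1 - c) * (1 + t))"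
    using False t by (intro mult_nonneg_nonneg) auto
  then show ?thesis using False by (simp add: disc_max_def algebra_simps power2_eq_square)
qed

lemma disc_quadratic_bound:
  fixes c B :: real and x y :: complex
  assumes c: "0 \<le> c" "c \<le> 1" and x: "cmod x \<le> 1" and y: "cmod y \<le> 1"
  shows "cmod ((1 - (cmod x)\<^sup>2) * y - c * x\<^sup>2 + B * x) \<le> disc_max c B"
proof -
  have x2: "(cmod x)\<^sup>2 \<le> 1" using x by (simp add: power_le_one)
  have "cmod ((1 - (cmod x)\<^sup>2) * y - c * x\<^sup>2 + B * x)
      \<le> cmod ((1 - (cmod x)\<^sup>2) * y) + cmod (c * x\<^sup>2) + cmod (B * x)"
    by (intro order.trans[OF norm_triangle_ineq] add_right_mono norm_triangle_ineq4)
  also have "\<dots> = (1 - (cmod x)\<^sup>2) * cmod y + c * (cmod x)\<^sup>2 + \<bar>B\<bar> * cmod x"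
    unfolding norm_mult norm_of_real norm_power using c x2 by simp
  also have "\<dots> \<le> 1 - (cmod x)\<^sup>2 + c * (cmod x)\<^sup>2 + \<bar>B\<bar> * cmod x"
    using mult_left_mono[OF y, of "1 - (cmod x)\<^sup>2"] x2 by simp
  also have "\<dots> \<le> disc_max c B"
    using disc_quadratic_le[OF c(2) norm_ge_zero x] .
  finally show ?thesis .
qed

text \<open>
  Taking \<open>y = -1\<close> and \<open>x\<close> of sign opposite to \<open>B\<close> makes all three terms nonpositive. The negative of the
  maximum is the value needed, because the term \<open>E\<close> is subtracted from this expression afterwards.
\<close>
lemma disc_quadratic_attained:
  fixes c B :: real
  assumes c: "c \<le> 1"
  obtains x :: real where "\<bar>x\<bar> \<le> 1" "(1 - x\<^sup>2) * (-1) - c * x\<^sup>2 + B * x = - disc_max c B"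
proof (cases "\<bar>B\<bar> \<le> 2 * (1 - c)")
  case True
  show ?thesis
  proof (cases "c = 1")
    case True
    then show ?thesis using that[of 0] \<open>\<bar>B\<bar> \<le> 2 * (1 - c)\<close> by (simp add: disc_max_def)
  next
    case False
    then have c1: "0 < 1 - c" using c by simp
    define x where "x = - B / (2 * (1 - c))"
    have "2 * (1 - c) \<noteq> 0" using c1 by simp
    then have "2 * (1 - c) * x = - B"
      unfolding x_def times_divide_eq_right by (rule nonzero_mult_div_cancel_left)
    then have Bx: "B = - 2 * (1 - c) * x" by linarith
    have "\<bar>x\<bar> \<le> 1" using True c1 by (simp add: x_def abs_le_iff field_simps)
    moreover have "B\<^sup>2 = (1 - c) * x\<^sup>2 * (4 * (1 - c))"
      unfolding Bx by (simp add: power2_eq_square algebra_simps)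
    then have "disc_max c B = 1 + (1 - c) * x\<^sup>2"
      using True c1 by (simp add: disc_max_def nonzero_divide_eq_eq)
    then have "(1 - x\<^sup>2) * (-1) - c * x\<^sup>2 + B * x = - disc_max c B"
      by (simp add: Bx algebra_simps power2_eq_square)
    ultimately show ?thesis by (rule that)
  qed
next
  case False
  then have "B \<noteq> 0" using c by auto
  then have "B * sgn B = \<bar>B\<bar>" "(sgn B)\<^sup>2 = 1" by (simp_all add: sgn_if abs_if)
  then show ?thesis using that[of "- sgn B"] False \<open>B \<noteq> 0\<close> by (simp add: disc_max_def abs_sgn_eq)
qed

text \<open>
  The number \<open>27/17\<close> is the quotient of the coefficients \<open>9/4\<close> and \<open>17/12\<close> in \<open>E\<close>. The bound follows from
  \<open>sin (\<pi>/6) = 1/2 < sin (9/17)\<close>, the latter by the Taylor polynomial of degree three.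
\<close>
lemma pi_half_le: "pi / 2 \<le> (27 / 17 :: real)"
proof (rule ccontr)
  assume "\<not> pi / 2 \<le> (27 / 17 :: real)"
  then have "sin (9 / 17 :: real) \<le> sin (pi / 6)"
    by (intro sin_monotone_2pi_le) auto
  then have "sin (9 / 17 :: real) \<le> 1 / 2" by (simp add: sin_30)
  moreover have "\<bar>sin (9 / 17 :: real) - (\<Sum>m<5. sin_coeff m * (9 / 17) ^ m)\<bar> \<le> inverse (fact 5) * \<bar>9 / 17\<bar> ^ 5"
    by (rule Maclaurin_sin_bound)
  then have "\<bar>sin (9 / 17 :: real) - (9 / 17 - (9 / 17) ^ 3 / 6)\<bar> \<le> (9 / 17) ^ 5 / 120"
    by (simp add: eval_nat_numeral sin_coeff_Suc cos_coeff_Suc)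
  then have "9 / 17 - (9 / 17) ^ 3 / 6 - (9 / 17) ^ 5 / 120 \<le> sin (9 / 17 :: real)"
    by linarith
  ultimately show False by (simp add: eval_nat_numeral)
qed

section \<open>The piecewise bounds in closed form\<close>

text \<open>
  The branches of \<open>\<Phi>\<close>, \<open>\<Psi>\<^sub>1\<close> and \<open>\<Psi>\<^sub>2\<close> come from resolving an absolute value and the two cases of
  \<open>disc_max\<close>.
\<close>
lemma Phi_eq:
  assumes "0 < lam" "0 \<le> c"
  shows "Phi lam (2 * c) = lam / 2 * ((1 - c\<^sup>2) + \<bar>2 * c - 3 / 2 * lam * c\<^sup>2\<bar>)"
proof -
  have "2 * c \<le> 8 / (3 * lam) \<longleftrightarrow> 3 / 2 * lam * c \<le> 2"
    using assms by (simp add: field_simps)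
  moreover have "2 * c - 3 / 2 * lam * c\<^sup>2 = c * (2 - 3 / 2 * lam * c)"
    by (simp add: algebra_simps power2_eq_square)
  then have "\<bar>2 * c - 3 / 2 * lam * c\<^sup>2\<bar> = c * \<bar>2 - 3 / 2 * lam * c\<bar>"
    using assms by (simp add: abs_mult)
  ultimately show ?thesis
    by (cases "3 / 2 * lam * c \<le> 2") (simp_all add: Phi_def power2_eq_square field_simps)
qed

lemma Psi_eq:
  assumes lam: "0 < lam" and c: "0 \<le> c" "c \<le> 1"
  shows "(if lam \<le> 3 / 5 then Psi1 lam (2 * c) else Psi2 lam (2 * c)) =
    lam / 3 * ((1 - c\<^sup>2) * disc_max c (5 / 2 * lam * c - 3 / 2) + (9 / 4 * lam * c\<^sup>2 - 17 / 12 * lam\<^sup>2 * c ^ 3))"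
    (is "_ = lam / 3 * ((1 - c\<^sup>2) * disc_max c ?B + ?E)")
proof -
  have lc: "lam * c \<le> lam" using lam c mult_left_mono[of c 1 lam] by simp
  show ?thesis
  proof (cases "lam \<le> 3 / 5")
    case True
    then have "?B \<le> 0" "0 < 4 - 5 * lam" using lc by linarith+
    then have cond: "2 * c \<le> 2 / (4 - 5 * lam) \<longleftrightarrow> \<bar>?B\<bar> \<le> 2 * (1 - c)"
      by (simp add: pos_le_divide_eq algebra_simps) argo
    show ?thesis
    proof (cases "\<bar>?B\<bar> \<le> 2 * (1 - c)")
      case t: True
      show ?thesis
        using True t unfolding Psi1_def cond disc_max_interior[OF c(2) t]
        by (simp add: field_simps power2_eq_square power3_eq_cube)
    next
      case f: False
      have abs_B: "\<bar>?B\<bar> = - ?B" using \<open>?B \<le> 0\<close> by simp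
      have dm: "disc_max c ?B = c + \<bar>?B\<bar>" using f by (simp add: disc_max_def)
      show ?thesis
        using True f unfolding Psi1_def cond dm abs_B
        by (simp add: field_simps power2_eq_square power3_eq_cube)
    qed
  next
    case False
    then have l: "0 < 4 + 5 * lam" by simp
    \<comment> \<open>equivalent to \<open>- B \<le> 2 (1 - c)\<close>, so that the case split depends on \<open>B\<close> alone and not on \<open>|B|\<close>\<close>
    have "c * (4 - 5 * lam) \<le> 1"
      using mult_left_mono[of "4 - 5 * lam" 1 c] False c by linarith
    have cond: "2 * c \<le> 14 / (4 + 5 * lam) \<longleftrightarrow> \<bar>?B\<bar> \<le> 2 * (1 - c)"
      using l \<open>c * (4 - 5 * lam) \<le> 1\<close> by (simp add: pos_le_divide_eq algebra_simps) argo
    show ?thesis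
    proof (cases "\<bar>?B\<bar> \<le> 2 * (1 - c)")
      case t: True
      show ?thesis
        using False t unfolding Psi2_def cond disc_max_interior[OF c(2) t]
        by (simp add: field_simps power2_eq_square power3_eq_cube)
    next
      case f: False
      have abs_B: "\<bar>?B\<bar> = ?B" using f \<open>c * (4 - 5 * lam) \<le> 1\<close> by (simp add: abs_if algebra_simps split: if_splits)
      have dm: "disc_max c ?B = c + \<bar>?B\<bar>" using f by (simp add: disc_max_def)
      show ?thesis
        using False f unfolding Psi2_def cond dm abs_B
        by (simp add: field_simps power2_eq_square power3_eq_cube)
    qed
  qed
qed

section \<open>The sharp inequalities\<close>

text \<open>The modulus is largest when \<open>x\<close> is unimodular and opposite in sign to \<open>2 c - 3/2 \<lambda> c\<^sup>2\<close>.\<close>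
lemma sharp_a3_minus_a2:
  assumes lam: "0 < lam" and c: "0 \<le> c" "c \<le> 1"
  shows "sharp_bound (starlike_exp_at lam (2 * lam * c))
    (\<lambda>f. cmod (taylor_coeff f 3 - taylor_coeff f 2))
    (lam / 2 * ((1 - c\<^sup>2) + \<bar>2 * c - 3 / 2 * lam * c\<^sup>2\<bar>))"
proof (rule sharp_boundI)
  define k where "k = 2 * c - 3 / 2 * lam * c\<^sup>2"
  have c2: "c\<^sup>2 \<le> 1" using c by (simp add: power_le_one)
  {
    fix f assume "f \<in> starlike_exp_at lam (2 * lam * c)"
    then obtain x y :: complex where x: "cmod x \<le> 1" and
      a: "taylor_coeff f 2 = lam * c" "taylor_coeff f 3 = lam / 2 * (1 - c\<^sup>2) * x + 3 / 4 * lam\<^sup>2 * c\<^sup>2"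
      by (rule starlike_exp_at_coeffs[OF lam]) simp
    have "taylor_coeff f 3 - taylor_coeff f 2 = complex_of_real (lam / 2) * (complex_of_real (1 - c\<^sup>2) * x - complex_of_real k)"
      unfolding a k_def by (simp add: field_simps power2_eq_square)
    then have "cmod (taylor_coeff f 3 - taylor_coeff f 2)
        = lam / 2 * cmod (complex_of_real (1 - c\<^sup>2) * x - complex_of_real k)"
      using lam by (simp only: norm_mult norm_of_real)
    also have "\<dots> \<le> lam / 2 * (cmod (complex_of_real (1 - c\<^sup>2) * x) + cmod (complex_of_real k))"
      using lam by (intro mult_left_mono norm_triangle_ineq4) simp
    also have "\<dots> = lam / 2 * ((1 - c\<^sup>2) * cmod x + \<bar>k\<bar>)"
      using c2 by (simp only: norm_mult norm_of_real)
    also have "\<dots> \<le> lam / 2 * ((1 - c\<^sup>2) + \<bar>k\<bar>)"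
      using lam x c2 mult_left_mono[OF x, of "1 - c\<^sup>2"] by (intro mult_left_mono) auto
    finally show "cmod (taylor_coeff f 3 - taylor_coeff f 2) \<le> lam / 2 * ((1 - c\<^sup>2) + \<bar>2 * c - 3 / 2 * lam * c\<^sup>2\<bar>)"
      unfolding k_def .
  }
  define x :: real where "x = (if 0 \<le> k then -1 else 1)"
  obtain f where f: "f \<in> starlike_exp_at lam (2 * lam * c)" "taylor_coeff f 2 = lam * c"
    "taylor_coeff f 3 = lam / 2 * (1 - c\<^sup>2) * x + 3 / 4 * lam\<^sup>2 * c\<^sup>2"
    by (rule starlike_exp_at_with_coeffs[of c x 0]) (use c in \<open>auto simp: x_def\<close>)
  have "taylor_coeff f 3 - taylor_coeff f 2 = complex_of_real (lam / 2 * ((1 - c\<^sup>2) * x - k))"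
    unfolding f(2,3) k_def by (simp add: field_simps power2_eq_square)
  then have "cmod (taylor_coeff f 3 - taylor_coeff f 2) = lam / 2 * \<bar>(1 - c\<^sup>2) * x - k\<bar>"
    using lam by (simp only: norm_of_real abs_mult)
  also have "\<bar>(1 - c\<^sup>2) * x - k\<bar> = (1 - c\<^sup>2) + \<bar>k\<bar>"
    using c2 by (auto simp: x_def)
  finally show "\<exists>f\<in>starlike_exp_at lam (2 * lam * c). cmod (taylor_coeff f 3 - taylor_coeff f 2)
      = lam / 2 * ((1 - c\<^sup>2) + \<bar>2 * c - 3 / 2 * lam * c\<^sup>2\<bar>)"
    using f(1) unfolding k_def by blast
qed

text \<open>
  As \<open>E \<ge> 0\<close>, the largest modulus occurs where the expression in \<open>x\<close> and \<open>y\<close> takes the value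
  \<open>- disc_max c B\<close>, pointing in the same direction as \<open>- E\<close>.
\<close>
lemma sharp_a4_minus_a3:
  assumes lam: "0 < lam" "lam \<le> pi / 2" and c: "0 \<le> c" "c \<le> 1"
  shows "sharp_bound (starlike_exp_at lam (2 * lam * c))
    (\<lambda>f. cmod (taylor_coeff f 4 - taylor_coeff f 3))
    (lam / 3 * ((1 - c\<^sup>2) * disc_max c (5 / 2 * lam * c - 3 / 2) + (9 / 4 * lam * c\<^sup>2 - 17 / 12 * lam\<^sup>2 * c ^ 3)))"
proof (rule sharp_boundI)
  define B where "B = 5 / 2 * lam * c - 3 / 2"
  define E where "E = 9 / 4 * lam * c\<^sup>2 - 17 / 12 * lam\<^sup>2 * c ^ 3"
  have c2: "c\<^sup>2 \<le> 1" using c by (simp add: power_le_one)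
  have "lam * c \<le> lam" using lam c mult_left_mono[of c 1 lam] by simp
  then have "lam * c \<le> 27 / 17" using pi_half_le lam by linarith
  then have "0 \<le> 9 / 4 - 17 / 12 * (lam * c)" by linarith
  then have "0 \<le> lam * c\<^sup>2 * (9 / 4 - 17 / 12 * (lam * c))"
    using lam by (intro mult_nonneg_nonneg) simp_all
  then have E: "0 \<le> E"
    unfolding E_def by (simp add: algebra_simps power2_eq_square power3_eq_cube)
  {
    fix f assume "f \<in> starlike_exp_at lam (2 * lam * c)"
    then obtain x y :: complex where xy: "cmod x \<le> 1" "cmod y \<le> 1" and
      a: "taylor_coeff f 3 = lam / 2 * (1 - c\<^sup>2) * x + 3 / 4 * lam\<^sup>2 * c\<^sup>2"
        "taylor_coeff f 4 = lam / 3 * ((1 - c\<^sup>2) * ((1 - (cmod x)\<^sup>2) * y - c * x\<^sup>2 + 5 / 2 * lam * c * x)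
          + 17 / 12 * lam\<^sup>2 * c ^ 3)"
      by (rule starlike_exp_at_coeffs[OF lam(1)]) simp
    define V where "V = complex_of_real (1 - (cmod x)\<^sup>2) * y - c * x\<^sup>2 + B * x"
    have V: "cmod V \<le> disc_max c B"
      unfolding V_def by (rule disc_quadratic_bound[OF c xy])
    have "taylor_coeff f 4 - taylor_coeff f 3 = complex_of_real (lam / 3) * (complex_of_real (1 - c\<^sup>2) * V - complex_of_real E)"
      unfolding a V_def B_def E_def by (simp add: field_simps power2_eq_square power3_eq_cube)
    then have "cmod (taylor_coeff f 4 - taylor_coeff f 3)
        = lam / 3 * cmod (complex_of_real (1 - c\<^sup>2) * V - complex_of_real E)"
      using lam by (simp only: norm_mult norm_of_real)
    also have "\<dots> \<le> lam / 3 * (cmod (complex_of_real (1 - c\<^sup>2) * V) + cmod (complex_of_real E))"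
      using lam by (intro mult_left_mono norm_triangle_ineq4) simp
    also have "\<dots> = lam / 3 * ((1 - c\<^sup>2) * cmod V + E)"
      using c2 E by (simp only: norm_mult norm_of_real)
    also have "\<dots> \<le> lam / 3 * ((1 - c\<^sup>2) * disc_max c B + E)"
      using lam c2 mult_left_mono[OF V, of "1 - c\<^sup>2"] by (intro mult_left_mono) auto
    finally show "cmod (taylor_coeff f 4 - taylor_coeff f 3)
        \<le> lam / 3 * ((1 - c\<^sup>2) * disc_max c (5 / 2 * lam * c - 3 / 2) + (9 / 4 * lam * c\<^sup>2 - 17 / 12 * lam\<^sup>2 * c ^ 3))"
      unfolding B_def E_def .
  }
  obtain x where x: "\<bar>x\<bar> \<le> 1" "(1 - x\<^sup>2) * (-1) - c * x\<^sup>2 + B * x = - disc_max c B"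
    by (rule disc_quadratic_attained[OF c(2)])
  obtain f where f: "f \<in> starlike_exp_at lam (2 * lam * c)"
    "taylor_coeff f 3 = lam / 2 * (1 - c\<^sup>2) * x + 3 / 4 * lam\<^sup>2 * c\<^sup>2"
    "taylor_coeff f 4 = lam / 3 * ((1 - c\<^sup>2) * ((1 - x\<^sup>2) * (-1) - c * x\<^sup>2 + 5 / 2 * lam * c * x)
      + 17 / 12 * lam\<^sup>2 * c ^ 3)"
    by (rule starlike_exp_at_with_coeffs[of c x "-1"]) (use c x in auto)
  have "taylor_coeff f 4 - taylor_coeff f 3
      = complex_of_real (lam / 3 * ((1 - c\<^sup>2) * ((1 - x\<^sup>2) * (-1) - c * x\<^sup>2 + B * x) - E))"
    unfolding f(2,3) B_def E_def by (simp add: field_simps power2_eq_square power3_eq_cube)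
  then have "taylor_coeff f 4 - taylor_coeff f 3 = - complex_of_real (lam / 3 * ((1 - c\<^sup>2) * disc_max c B + E))"
    unfolding x(2) by (simp add: algebra_simps)
  moreover have "0 \<le> (1 - c\<^sup>2) * disc_max c B + E"
    using order.trans[OF norm_ge_zero disc_quadratic_bound[OF c, of 0 0]] c2 E by simp
  ultimately have "cmod (taylor_coeff f 4 - taylor_coeff f 3) = lam / 3 * ((1 - c\<^sup>2) * disc_max c B + E)"
    using lam by (simp only: norm_minus_cancel norm_of_real abs_mult)
  then show "\<exists>f\<in>starlike_exp_at lam (2 * lam * c). cmod (taylor_coeff f 4 - taylor_coeff f 3)
      = lam / 3 * ((1 - c\<^sup>2) * disc_max c (5 / 2 * lam * c - 3 / 2) + (9 / 4 * lam * c\<^sup>2 - 17 / 12 * lam\<^sup>2 * c ^ 3))"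
    using f(1) unfolding B_def E_def by blast
qed

theorem theorem3:
  fixes lam p_hat p :: real
  assumes "0 < lam" and "lam \<le> pi / 2"
    and "0 \<le> p_hat" and "p_hat \<le> 2 * lam"
    and "p = p_hat / lam"
  shows "sharp_bound (starlike_exp_at lam p_hat)
           (\<lambda>f. cmod (taylor_coeff f 3 - taylor_coeff f 2))
           (Phi lam p)
       \<and> sharp_bound (starlike_exp_at lam p_hat)
           (\<lambda>f. cmod (taylor_coeff f 4 - taylor_coeff f 3))
           (if lam \<le> 3 / 5 then Psi1 lam p else Psi2 lam p)"
proof -
  define c where "c = p_hat / (2 * lam)"
  have c: "0 \<le> c" "c \<le> 1" and p: "p = 2 * c" and p_hat: "p_hat = 2 * lam * c"
    using assms by (simp_all add: c_def)
  show ?thesis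
    unfolding p p_hat Phi_eq[OF assms(1) c(1)] Psi_eq[OF assms(1) c]
    using sharp_a3_minus_a2[OF assms(1) c] sharp_a4_minus_a3[OF assms(1,2) c] by blast
qed

end
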